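(* Let $0<\varepsilon<1$. Let $G$ be a graph and $F\subseteq G$ an induced forest without isolated vertices such that $$|F|-l(F)+c(F)\ge \varepsilon |G|,$$ where $l(F)$ is the number of leaves and $c(F)$ the number of connected components of $F$. Let $\ell$ denote the number of distinct Laplacian eigenvalues of $G$. Then $$\ell\ge \frac{1}{1-\varepsilon}.$$ The statement remains true if "Laplacian" is replaced by "normalized Laplacian" or by "adjacency matrix".
   Context: A graph $G=(V,E)$ is a pair of finite sets with $V\neq\emptyset$ and $E$ a set of $2$-element subsets of $V$; $|G|=|V|$. An induced forest is an induced subgraph that is a forest; its isolated vertices and leaves are its vertices of degree $0$ and $1$, respectively, inside it. With $A$ the adjacency matrix and $D$ the diagonal degree matrix, the Laplacian is $D-A$, and the normalized Laplacian is the matrix with entry $-1/\sqrt{\deg v\deg w}$ for adjacent $v,w$, diagonal entry $1$ at each vertex of positive degree, and all other entries $0$. *)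

theory Defs
  imports Complex_Main "Jordan_Normal_Form.Spectral_Radius"
begin

type_synonym 'a ugraph = "'a set \<times> 'a set set"

abbreviation verts :: "'a ugraph \<Rightarrow> 'a set" where "verts \<equiv> fst"
abbreviation edges :: "'a ugraph \<Rightarrow> 'a set set" where "edges \<equiv> snd"

definition graph :: "'a ugraph \<Rightarrow> bool" where
  "graph G \<longleftrightarrow> finite (verts G) \<and> verts G \<noteq> {} \<and>
     (\<forall>e \<in> edges G. e \<subseteq> verts G \<and> card e = 2)"

definition vdegree :: "'a ugraph \<Rightarrow> 'a \<Rightarrow> nat" where
  "vdegree G v = card {e \<in> edges G. v \<in> e}"

definition induced_subgraph :: "'a ugraph \<Rightarrow> 'a ugraph \<Rightarrow> bool" where
  "induced_subgraph F G \<longleftrightarrow>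
     graph F \<and> verts F \<subseteq> verts G \<and> edges F = {e \<in> edges G. e \<subseteq> verts F}"

(* Vertices listed once around, without repeating the first one at the end. *)
definition is_cycle :: "'a ugraph \<Rightarrow> 'a list \<Rightarrow> bool" where
  "is_cycle G p \<longleftrightarrow> 3 \<le> length p \<and> distinct p \<and> set p \<subseteq> verts G \<and>
     (\<forall>i < length p. {p ! i, p ! (Suc i mod length p)} \<in> edges G)"

definition forest :: "'a ugraph \<Rightarrow> bool" where
  "forest G \<longleftrightarrow> graph G \<and> (\<nexists>p. is_cycle G p)"

definition isolated_vertices :: "'a ugraph \<Rightarrow> 'a set" where
  "isolated_vertices G = {v \<in> verts G. vdegree G v = 0}"

definition leaves :: "'a ugraph \<Rightarrow> 'a set" where
  "leaves G = {v \<in> verts G. vdegree G v = 1}"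

definition reachable :: "'a ugraph \<Rightarrow> ('a \<times> 'a) set" where
  "reachable G = {(u, v). u \<in> verts G \<and> v \<in> verts G \<and>
     (u, v) \<in> {(x, y). {x, y} \<in> edges G}\<^sup>*}"

definition components :: "'a ugraph \<Rightarrow> 'a set set" where
  "components G = verts G // reachable G"

(* The list vs enumerates the vertices and so fixes the order of rows and columns;
   the spectrum does not depend on it. *)
definition adjacency_matrix :: "'a ugraph \<Rightarrow> 'a list \<Rightarrow> real mat" where
  "adjacency_matrix G vs = mat (length vs) (length vs)
     (\<lambda>(i, j). if {vs ! i, vs ! j} \<in> edges G then 1 else 0)"

definition degree_matrix :: "'a ugraph \<Rightarrow> 'a list \<Rightarrow> real mat" where
  "degree_matrix G vs = mat (length vs) (length vs)
     (\<lambda>(i, j). if i = j then real (vdegree G (vs ! i)) else 0)"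

definition laplacian :: "'a ugraph \<Rightarrow> 'a list \<Rightarrow> real mat" where
  "laplacian G vs = degree_matrix G vs - adjacency_matrix G vs"

definition normalized_laplacian :: "'a ugraph \<Rightarrow> 'a list \<Rightarrow> real mat" where
  "normalized_laplacian G vs = mat (length vs) (length vs)
     (\<lambda>(i, j).
        if {vs ! i, vs ! j} \<in> edges G
          then - 1 / sqrt (real (vdegree G (vs ! i)) * real (vdegree G (vs ! j)))
        else if i = j \<and> vdegree G (vs ! i) > 0 then 1
        else 0)"

end

theory Submission
  imports Defs "Jordan_Normal_Form.Jordan_Normal_Form_Uniqueness"
begin

text \<open>
  Let \<open>M\<close> be a real symmetric matrix of order \<open>n\<close> whose off-diagonal entries are nonzero exactly at the
  edges of \<open>G\<close>; the three matrices in question are of this kind. The diagonal of \<open>M\<close> is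
  arbitrary, so \<open>M - \<mu>\<close> is again of this kind for every eigenvalue \<open>\<mu>\<close>. The point is that a large
  induced forest \<open>F\<close> forces all these matrices to have large rank: with
  \<open>m = |F| - l(F) + c(F)\<close>, the rank is at least \<open>m\<close>. Every eigenvalue then has multiplicity
  at most \<open>n - m \<le> (1 - \<epsilon>) n\<close>. As \<open>M\<close> is diagonalizable, the multiplicities add up to \<open>n\<close>, which
  leaves at least \<open>1 / (1 - \<epsilon>)\<close> distinct eigenvalues.

  The rank bound comes from a triangular submatrix that avoids the diagonal of \<open>M\<close>. Its combinatorial
  form is a \<open>forcing_chain\<close>: a list of edges \<open>(v, c)\<close> such that each \<open>v\<close> is neither equal nor
  adjacent to any later \<open>c\<close>. For a tree, one may think of rooting it at a leaf and letting every vertex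
  with children choose one of them, in order of increasing distance from the root; this gives one pair
  for each vertex except the leaves other than the root.
  The formal argument needs no roots or distances: \<open>forest_forcing_chain\<close> builds the chain by induction,
  removing one pendant edge at a time. Since \<open>F\<close> is induced, its chain is also one of \<open>G\<close>.

  On the linear algebra side, \<open>forcing_chain_determines_eigenvectors\<close> shows that an eigenvector is
  determined by its coordinates off the columns \<open>c\<close> of the chain,
  \<open>real_symmetric_diagonalizable\<close> supplies the diagonal form, and
  \<open>dim_le_card_spectrum_times_card_determining_set\<close> does the counting.
\<close>

section \<open>Pendant edges and components of a forest\<close>

text \<open>
  A longest path must start at a leaf: a second edge at its first vertex would either
  prolong the path or return to it and close a cycle.
\<close>

lemma forest_has_leaf:
  assumes "forest (V, E)" and "E \<noteq> {}"
  obtains x y where "{x, y} \<in> E" and "\<And>e. e \<in> E \<Longrightarrow> x \<in> e \<Longrightarrow> e = {x, y}"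
proof -
  have fin: "finite V" and E: "\<And>e. e \<in> E \<Longrightarrow> e \<subseteq> V \<and> card e = 2"
    and acyclic: "\<And>p. \<not> is_cycle (V, E) p"
    using assms(1) by (auto simp: forest_def graph_def)
  let ?path = "\<lambda>p. set p \<subseteq> V \<and> distinct p \<and> 2 \<le> length p \<and>
    (\<forall>i. Suc i < length p \<longrightarrow> {p ! i, p ! Suc i} \<in> E)"
  obtain e where "e \<in> E" using assms(2) by blast
  then obtain a b where ab: "{a, b} \<in> E" "a \<noteq> b"
    using E card_2_iff by metis
  have "?path [a, b]" using ab E by (auto simp: less_Suc_eq)
  moreover have "\<forall>p. ?path p \<longrightarrow> length p < Suc (card V)"
    using fin by (metis card_mono distinct_card less_Suc_eq_le)
  ultimately obtain p where p: "?path p" and max: "\<And>q. ?path q \<Longrightarrow> length q \<le> length p"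
    using ex_has_greatest_nat[of ?path "[a, b]" length "Suc (card V)"] by blast
  then obtain x y r where pxy: "p = x # y # r"
    by (metis Suc_le_length_iff numeral_2_eq_2)
  have "{x, y} \<in> E" using p unfolding pxy by force
  moreover have "e = {x, y}" if e: "e \<in> E" "x \<in> e" for e
  proof (rule ccontr)
    assume ne: "e \<noteq> {x, y}"
    obtain z where z: "e = {x, z}" "z \<noteq> x"
      using E[OF e(1)] e(2) by (metis card_2_iff insertE insert_commute singletonD)
    have zV: "z \<in> V" using E e z by auto
    have "z \<in> set p"
    proof (rule ccontr)
      assume "z \<notin> set p"
      have "{(z # p) ! i, (z # p) ! Suc i} \<in> E" if "Suc i < length (z # p)" for i
        using that p e z by (cases i) (auto simp: pxy insert_commute)
      then have "?path (z # p)" using p zV \<open>z \<notin> set p\<close> by auto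
      from max[OF this] show False by simp
    qed
    then obtain j where j: "j < length p" "p ! j = z" by (auto simp: in_set_conv_nth)
    have j2: "2 \<le> j"
    proof (rule ccontr)
      assume "\<not> 2 \<le> j"
      then have "j = 0 \<or> j = 1" by linarith
      then show False using j z ne by (auto simp: pxy)
    qed
    have "is_cycle (V, E) (take (Suc j) p)"
      unfolding is_cycle_def
    proof (intro conjI allI impI)
      show "3 \<le> length (take (Suc j) p)" using j j2 by simp
      show "distinct (take (Suc j) p)" using p by simp
      show "set (take (Suc j) p) \<subseteq> verts (V, E)" using p set_take_subset by fastforce
      fix i assume "i < length (take (Suc j) p)"
      then have i: "i < Suc j" by simp
      have len: "length (take (Suc j) p) = Suc j" using j by simp
      show "{take (Suc j) p ! i, take (Suc j) p ! (Suc i mod length (take (Suc j) p))} \<in> edges (V, E)"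
      proof (cases "i = j")
        case True
        have "take (Suc j) p ! j = z" using j by simp
        moreover have "take (Suc j) p ! 0 = x" by (simp add: pxy)
        ultimately show ?thesis using True e z unfolding len by (simp add: insert_commute)
      next
        case False
        then show ?thesis using i p j unfolding len by simp
      qed
    qed
    with acyclic show False by blast
  qed
  ultimately show thesis using that by blast
qed

lemma equiv_reachable: "equiv (verts G) (reachable G)"
proof (intro equivI)
  show "reachable G \<subseteq> verts G \<times> verts G" by (auto simp: reachable_def)
  show "refl_on (verts G) (reachable G)" by (auto simp: reachable_def refl_on_def)
  have "sym {(x, y). {x, y} \<in> edges G}" by (auto simp: sym_def insert_commute)
  then show "sym (reachable G)"
    using sym_rtrancl unfolding reachable_def sym_def by blast
  show "trans (reachable G)" by (auto simp: reachable_def trans_def)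
qed

text \<open>
  Deleting the edge turns the leaf \<open>x\<close> into a component of its own and separates nothing else:
  with the edge restored, every component arises by growing a component other than \<open>{x}\<close>, since
  the component of \<open>x\<close> is also that of \<open>y\<close>.
\<close>

lemma card_components_remove_pendant_edge:
  assumes "graph (V, E)" and "{x, y} \<in> E"
    and pendant: "\<And>e. e \<in> E \<Longrightarrow> x \<in> e \<Longrightarrow> e = {x, y}"
  shows "card (components (V, E)) < card (components (V, E - {{x, y}}))"
proof -
  let ?G = "(V, E)" and ?H = "(V, E - {{x, y}})"
  let ?R = "reachable ?G" and ?S = "reachable ?H"
  have fin: "finite V" and xy: "x \<in> V" "y \<in> V" "x \<noteq> y"
    using assms(1,2) by (auto simp: graph_def)
  have eqR: "equiv V ?R" and eqS: "equiv V ?S"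
    using equiv_reachable[of ?G] equiv_reachable[of ?H] by simp_all
  have SR: "?S \<subseteq> ?R"
  proof -
    have "{(a, b). {a, b} \<in> E - {{x, y}}}\<^sup>* \<subseteq> {(a, b). {a, b} \<in> E}\<^sup>*"
      by (rule rtrancl_mono) auto
    then show ?thesis by (auto simp: reachable_def)
  qed
  have isolated: "?S `` {x} = {x}"
  proof -
    have "b = x" if "(x, b) \<in> {(a, b). {a, b} \<in> E - {{x, y}}}\<^sup>*" for b
      using that pendant by (induction rule: rtrancl_induct) auto
    then show ?thesis using xy by (auto simp: reachable_def)
  qed
  have "(x, y) \<in> ?R" using assms(2) xy by (auto simp: reachable_def)
  have sub: "components ?G \<subseteq> (\<lambda>C. ?R `` C) ` (components ?H - {{x}})"
  proof
    fix C assume "C \<in> components ?G"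
    then obtain u where u: "u \<in> V" "C = ?R `` {u}"
      by (auto simp: components_def quotient_def)
    obtain v where v: "v \<in> V" "v \<noteq> x" "C = ?R `` {v}"
    proof (cases "u = x")
      case True
      then show ?thesis
        using that[of y] xy u equiv_class_eq[OF eqR \<open>(x, y) \<in> ?R\<close>] by simp
    qed (use u that in blast)
    have "?S `` {v} \<in> components ?H" using v by (auto simp: components_def quotient_def)
    moreover have "v \<in> ?S `` {v}" using v by (auto simp: reachable_def)
    moreover have "?R `` (?S `` {v}) = C"
    proof
      show "?R `` (?S `` {v}) \<subseteq> C"
        using SR eqR v by (auto elim!: equivE dest: transD)
      show "C \<subseteq> ?R `` (?S `` {v})" using v \<open>v \<in> ?S `` {v}\<close> by blast
    qed
    ultimately show "C \<in> (\<lambda>C. ?R `` C) ` (components ?H - {{x}})" using v by blast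
  qed
  have finH: "finite (components ?H)"
    using fin unfolding components_def
    by (auto intro!: finite_quotient simp: reachable_def)
  have mem: "{x} \<in> components ?H"
    using isolated xy unfolding components_def quotient_def by auto
  have "card (components ?G) \<le> card (components ?H - {{x}})"
    using sub finH by (meson card_image_le card_mono finite_Diff finite_imageI le_trans)
  also have "\<dots> < card (components ?H)" using mem finH by (meson card_Diff1_less)
  finally show ?thesis .
qed

section \<open>Forcing chains\<close>

text \<open>
  In a matrix with off-diagonal pattern \<open>E\<close>, the rows \<open>v\<close> and columns \<open>c\<close> of the pairs in
  a forcing chain form a lower triangular submatrix with nonzero diagonal. Equality \<open>v = c'\<close> with
  a later column is excluded together with adjacency, because nothing is known about the diagonal
  entries of the matrix. In the language of zero forcing, the vertices other than the columns are
  coloured at the start, and each \<open>v\<close> in turn forces its only uncoloured neighbour \<open>c\<close>.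
\<close>

fun forcing_chain :: "'a set set \<Rightarrow> ('a \<times> 'a) list \<Rightarrow> bool" where
  "forcing_chain E [] \<longleftrightarrow> True"
| "forcing_chain E ((v, c) # ps) \<longleftrightarrow> {v, c} \<in> E \<and>
     (\<forall>c' \<in> snd ` set ps. v \<noteq> c' \<and> {v, c'} \<notin> E) \<and> forcing_chain E ps"

lemma forcing_chain_append_single:
  "forcing_chain E (ps @ [(v, c)]) \<longleftrightarrow>
    forcing_chain E ps \<and> (\<forall>w \<in> fst ` set ps. w \<noteq> c \<and> {w, c} \<notin> E) \<and> {v, c} \<in> E"
  by (induction E ps rule: forcing_chain.induct) auto

lemma forcing_chain_edge: "forcing_chain E ps \<Longrightarrow> (v, c) \<in> set ps \<Longrightarrow> {v, c} \<in> E"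
  by (induction E ps rule: forcing_chain.induct) auto

text \<open>
  Whichever of the two pairs comes first has its row equal to the column of the other.
\<close>

lemma forcing_chain_no_swap:
  "forcing_chain E ps \<Longrightarrow> (v, c) \<in> set ps \<Longrightarrow> (c, v) \<in> set ps \<Longrightarrow> v = c"
  by (induction E ps rule: forcing_chain.induct) force+

lemma forcing_chain_distinct: "forcing_chain E ps \<Longrightarrow> distinct (map snd ps)"
  by (induction E ps rule: forcing_chain.induct) auto

lemma forcing_chain_cong:
  assumes "forcing_chain E ps"
    and "\<And>v c. v \<in> fst ` set ps \<Longrightarrow> c \<in> snd ` set ps \<Longrightarrow> {v, c} \<in> E \<longleftrightarrow> {v, c} \<in> E'"
  shows "forcing_chain E' ps"
  using assms by (induction E ps rule: forcing_chain.induct) auto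

text \<open>
  The quantity on the left is chosen so that it behaves well under deleting a pendant edge
  \<open>{x, y}\<close> with leaf \<open>x\<close>. The contribution of \<open>x\<close> to the sum drops by one, which the new
  component compensates; the contribution of \<open>y\<close> drops by one exactly if \<open>y\<close> had degree at most
  two, and in that case the chain of the smaller forest has to be extended by one pair.
  If \<open>y\<close> is not yet a row, the pair \<open>(y, x)\<close> can be put last, as \<open>x\<close> has no other neighbour.
  If \<open>y\<close> is a row, then it is not a column, because its only remaining neighbour cannot serve in both
  roles, and the pair \<open>(x, y)\<close> can be put first, as \<open>x\<close> has no other neighbour.
\<close>

lemma forest_forcing_chain:
  assumes "forest (V, E)"
  shows "\<exists>ps. forcing_chain E ps \<and>
    (\<Sum>v\<in>V. min 2 (vdegree (V, E) v)) + card (components (V, E)) \<le> length ps + card V"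
  using assms
proof (induction "card E" arbitrary: E rule: less_induct)
  case less
  have g: "graph (V, E)" using less.prems by (simp add: forest_def)
  then have fin: "finite V" and E: "\<And>e. e \<in> E \<Longrightarrow> e \<subseteq> V \<and> card e = 2"
    by (auto simp: graph_def)
  have finE: "finite E" using fin E by (meson Pow_iff finite_Pow_iff finite_subset subsetI)
  show ?case
  proof (cases "E = {}")
    case True
    have "components (V, E) = (\<lambda>u. reachable (V, E) `` {u}) ` V"
      by (auto simp: components_def quotient_def)
    then have "card (components (V, E)) \<le> card V" using fin by (simp add: card_image_le)
    then show ?thesis using True by (intro exI[of _ "[]"]) (simp add: vdegree_def)
  next
    case False
    then obtain x y where xy: "{x, y} \<in> E"
      and pendant: "\<And>e. e \<in> E \<Longrightarrow> x \<in> e \<Longrightarrow> e = {x, y}"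
      using forest_has_leaf less.prems by metis
    have [simp]: "x \<noteq> y" "y \<noteq> x" and V: "x \<in> V" "y \<in> V" using E[OF xy] by auto
    define E' where "E' = E - {{x, y}}"
    let ?d = "vdegree (V, E)" and ?d' = "vdegree (V, E')"
    have noE': "x \<notin> e" if "e \<in> E'" for e using that pendant by (auto simp: E'_def)
    have "forest (V, E')"
      using less.prems by (auto simp: forest_def graph_def E'_def is_cycle_def)
    moreover have "card E' < card E" using finE xy unfolding E'_def by (meson card_Diff1_less)
    ultimately obtain ps where ps: "forcing_chain E' ps"
      and count: "(\<Sum>v\<in>V. min 2 (?d' v)) + card (components (V, E')) \<le> length ps + card V"
      using less.hyps by blast
    have comp: "card (components (V, E)) < card (components (V, E'))"
      unfolding E'_def by (rule card_components_remove_pendant_edge[OF g xy pendant])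
    have edge: "{v, c} \<in> E'" if "(v, c) \<in> set ps" for v c
      using forcing_chain_edge[OF ps that] .
    have x_fresh: "x \<notin> fst ` set ps" "x \<notin> snd ` set ps"
      using edge noE' by fastforce+
    have ps_E: "forcing_chain E ps"
    proof (rule forcing_chain_cong[OF ps])
      show "{v, c} \<in> E' \<longleftrightarrow> {v, c} \<in> E" if "v \<in> fst ` set ps" "c \<in> snd ` set ps" for v c
        using that x_fresh by (auto simp: E'_def doubleton_eq_iff)
    qed
    have deg: "?d x = Suc (?d' x)" "?d y = Suc (?d' y)"
      "\<And>v. v \<noteq> x \<Longrightarrow> v \<noteq> y \<Longrightarrow> ?d v = ?d' v"
    proof -
      have *: "{e \<in> E. v \<in> e} = insert {x, y} {e \<in> E'. v \<in> e}" if "v \<in> {x, y}" for v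
        using xy that by (auto simp: E'_def)
      have **: "card (insert {x, y} {e \<in> E'. v \<in> e}) = Suc (card {e \<in> E'. v \<in> e})" for v
        using finE by (subst card_insert_disjoint) (auto simp: E'_def)
      show "?d x = Suc (?d' x)" "?d y = Suc (?d' y)"
        by (simp_all add: vdegree_def * **)
      fix v assume "v \<noteq> x" "v \<noteq> y"
      then have "{e \<in> E. v \<in> e} = {e \<in> E'. v \<in> e}" by (auto simp: E'_def)
      then show "?d v = ?d' v" by (simp add: vdegree_def)
    qed
    have "{e \<in> E'. x \<in> e} = {}" using noE' by blast
    then have dx: "?d' x = 0" by (simp only: vdegree_def snd_conv card.empty)
    have split: "(\<Sum>v\<in>V. f v) = f x + f y + (\<Sum>v\<in>V - {x, y}. f v)" for f :: "'a \<Rightarrow> nat"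
    proof -
      have "V = insert x (insert y (V - {x, y}))" using V by auto
      then have "sum f V = sum f (insert x (insert y (V - {x, y})))" by simp
      also have "\<dots> = f x + f y + (\<Sum>v\<in>V - {x, y}. f v)" using fin by simp
      finally show ?thesis .
    qed
    have rest: "(\<Sum>v\<in>V - {x, y}. min 2 (?d v)) = (\<Sum>v\<in>V - {x, y}. min 2 (?d' v))"
      by (rule sum.cong) (auto simp: deg(3))
    \<comment> \<open>The extra 1 is the contribution of the leaf \<open>x\<close>; the component count absorbs it.\<close>
    have sums: "(\<Sum>v\<in>V. min 2 (?d v)) + min 2 (?d' y)
        = (\<Sum>v\<in>V. min 2 (?d' v)) + min 2 (?d y) + 1"
      using split[of "\<lambda>v. min 2 (?d v)"] split[of "\<lambda>v. min 2 (?d' v)"] rest dx deg(1) by simp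
    show ?thesis
    proof (cases "?d' y \<ge> 2")
      case True
      then show ?thesis using ps_E sums count comp deg(2) by (intro exI[of _ ps]) simp
    next
      case False
      have "\<exists>qs. forcing_chain E qs \<and> length qs = Suc (length ps)"
      proof (cases "y \<in> fst ` set ps")
        case notin: False
        have "forcing_chain E (ps @ [(y, x)])"
          unfolding forcing_chain_append_single
        proof (intro conjI ballI)
          show "forcing_chain E ps" by (rule ps_E)
          show "{y, x} \<in> E" using xy by (simp add: insert_commute)
          fix w assume w: "w \<in> fst ` set ps"
          then show "w \<noteq> x" using x_fresh by blast
          show "{w, x} \<notin> E"
            using pendant[of "{w, x}"] w notin x_fresh by (auto simp: doubleton_eq_iff)
        qed
        then show ?thesis by (intro exI[of _ "ps @ [(y, x)]"]) simp
      next
        case True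
        then obtain z where z: "(y, z) \<in> set ps" by auto
        have "y \<notin> snd ` set ps"
        proof
          assume "y \<in> snd ` set ps"
          then obtain w where w: "(w, y) \<in> set ps" by auto
          have "card {e \<in> E'. y \<in> e} \<le> Suc 0" using False by (simp add: vdegree_def)
          moreover have "finite {e \<in> E'. y \<in> e}" using finE by (simp add: E'_def)
          ultimately have "\<And>e f. e \<in> {e \<in> E'. y \<in> e} \<Longrightarrow> f \<in> {e \<in> E'. y \<in> e} \<Longrightarrow> e = f"
            using card_le_Suc0_iff_eq[of "{e \<in> E'. y \<in> e}"] by blast
          from this[of "{y, z}" "{w, y}"] have "{y, z} = {w, y}"
            using edge[OF z] edge[OF w] by simp
          then have "w = z" by (auto simp: doubleton_eq_iff)
          with forcing_chain_no_swap[OF ps z] w have "y = z" by simp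
          with edge[OF z] have "{z} \<in> E" by (simp add: E'_def)
          then show False using E[of "{z}"] by simp
        qed
        then have "x \<noteq> c \<and> {x, c} \<notin> E" if "c \<in> snd ` set ps" for c
          using that x_fresh(2) pendant[of "{x, c}"] by (auto simp: doubleton_eq_iff)
        then have "forcing_chain E ((x, y) # ps)"
          using ps_E xy by simp
        then show ?thesis by (intro exI[of _ "(x, y) # ps"]) simp
      qed
      then obtain qs where "forcing_chain E qs" "length qs = Suc (length ps)" by blast
      then show ?thesis using sums count comp deg(2) False by (intro exI[of _ qs]) simp
    qed
  qed
qed

text \<open>
  Without isolated vertices, \<open>min 2 (deg v)\<close> is 2 except at leaves, where it is 1.
\<close>

lemma forcing_chain_of_forest_without_isolated_vertices:
  assumes "forest F" and "isolated_vertices F = {}"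
  obtains ps where "forcing_chain (edges F) ps"
    and "card (verts F) + card (components F) \<le> length ps + card (leaves F)"
proof -
  have fin: "finite (verts F)" using assms(1) by (auto simp: forest_def graph_def)
  obtain ps where ps: "forcing_chain (edges F) ps"
    "(\<Sum>v\<in>verts F. min 2 (vdegree F v)) + card (components F) \<le> length ps + card (verts F)"
    using forest_forcing_chain[of "verts F" "edges F"] assms(1) by auto
  have "min 2 (vdegree F v) + of_bool (v \<in> leaves F) = 2" if "v \<in> verts F" for v
    using that assms(2) by (auto simp: isolated_vertices_def leaves_def min_def)
  then have "(\<Sum>v\<in>verts F. min 2 (vdegree F v) + of_bool (v \<in> leaves F)) = 2 * card (verts F)"
    by simp
  moreover have "(\<Sum>v\<in>verts F. of_bool (v \<in> leaves F)) = card (leaves F)"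
  proof -
    have "verts F \<inter> leaves F = leaves F" by (auto simp: leaves_def)
    then show ?thesis using fin by (simp add: of_bool_def sum.If_cases)
  qed
  ultimately have "(\<Sum>v\<in>verts F. min 2 (vdegree F v)) + card (leaves F) = 2 * card (verts F)"
    by (simp add: sum.distrib)
  with ps that show thesis by simp
qed

section \<open>Diagonalization of real symmetric matrices\<close>

text \<open>
  The characteristic polynomial splits over the complex numbers, and the Hermitian form
  \<open>v \<bullet>c v\<close> shows that each of its roots equals its own conjugate.
\<close>

lemma real_symmetric_char_poly_splits:
  fixes A :: "real mat"
  assumes A: "A \<in> carrier_mat n n" and sym: "transpose_mat A = A"
  obtains es where "char_poly A = (\<Prod>e\<leftarrow>es. [:- e, 1:])"
proof -
  let ?C = "map_mat complex_of_real A"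
  have C: "?C \<in> carrier_mat n n" using A by simp
  have symC: "transpose_mat ?C = ?C" using sym by (metis map_mat_transpose)
  obtain as where as: "char_poly ?C = (\<Prod>a\<leftarrow>as. [:- a, 1:])"
    using char_poly_factorized[OF C] by blast
  have real: "cnj a = a" if "a \<in> set as" for a
  proof -
    have "poly (char_poly ?C) a = 0"
      using that unfolding as by (auto simp: poly_prod_list prod_list_zero_iff)
    then obtain v where v: "v \<in> carrier_vec n" "v \<noteq> 0\<^sub>v n" "?C *\<^sub>v v = a \<cdot>\<^sub>v v"
      using eigenvalue_root_char_poly[OF C] A by (auto simp: eigenvalue_def eigenvector_def)
    have cv: "conjugate v \<in> carrier_vec n" using v by simp
    have "?C *\<^sub>v conjugate v = conjugate (?C *\<^sub>v v)"
      using A v(1) by (intro eq_vecI) (auto simp: scalar_prod_def)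
    then have Ccv: "?C *\<^sub>v conjugate v = cnj a \<cdot>\<^sub>v conjugate v"
      using v by (simp add: conjugate_smult_vec)
    have "a * (v \<bullet>c v) = (?C *\<^sub>v v) \<bullet> conjugate v" using v cv by simp
    also have "\<dots> = v \<bullet> (?C *\<^sub>v conjugate v)"
      using transpose_vec_mult_scalar[OF C cv v(1)] symC by simp
    also have "\<dots> = cnj a * (v \<bullet>c v)" unfolding Ccv using v cv by simp
    finally show ?thesis using v conjugate_square_eq_0_vec[OF v(1)] by simp
  qed
  define es where "es = map Re as"
  have as_es: "as = map complex_of_real es"
    unfolding es_def using real by (auto intro!: nth_equalityI simp: complex_eq_iff)
  interpret map_poly_hom: map_poly_comm_ring_hom complex_of_real ..
  have "map_poly complex_of_real (\<Prod>e\<leftarrow>es. [:- e, 1:]) = (\<Prod>a\<leftarrow>map complex_of_real es. [:- a, 1:])"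
    by (induction es) (simp_all add: map_poly_hom.hom_mult hom_distribs)
  also have "\<dots> = map_poly complex_of_real (char_poly A)"
    using as of_real_hom.char_poly_hom[OF A] as_es by metis
  finally have "char_poly A = (\<Prod>e\<leftarrow>es. [:- e, 1:])"
    by (simp add: poly_eq_iff coeff_map_poly)
  then show thesis by (rule that)
qed

lemma diagonal_jordan_matrix:
  assumes "\<And>m a. (m, a) \<in> set n_as \<Longrightarrow> m = 1"
  shows "diagonal_mat (jordan_matrix n_as)"
  using assms
proof (induction n_as)
  case Nil
  then show ?case by (auto simp: jordan_matrix_def diagonal_mat_def)
next
  case (Cons na n_as)
  obtain a where na: "na = (1, a)" using Cons.prems by (cases na) auto
  have "diagonal_mat (jordan_matrix n_as)" using Cons by auto
  then show ?case
    unfolding na jordan_matrix_Cons diagonal_mat_def by auto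
qed

text \<open>
  A Jordan block of size at least two for the eigenvalue \<open>a\<close> would make the kernel of
  \<open>(A - a)\<^sup>2\<close> larger than that of \<open>A - a\<close>. For symmetric \<open>B = A - a\<close> this is impossible: if
  \<open>B (B x) = 0\<close>, then \<open>B x \<bullet> B x = x \<bullet> B (B x) = 0\<close>.
\<close>

lemma real_symmetric_diagonalizable:
  fixes A :: "real mat"
  assumes A: "A \<in> carrier_mat n n" and sym: "transpose_mat A = A"
  obtains J where "similar_mat A J" and "diagonal_mat J"
proof -
  obtain es where "char_poly A = (\<Prod>e\<leftarrow>es. [:- e, 1:])"
    using real_symmetric_char_poly_splits[OF assms] .
  then obtain n_as where jnf: "jordan_nf A n_as" using jordan_nf_exists[OF A] by blast
  have block: "m = 1" if mem: "(m, a) \<in> set n_as" for m a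
  proof -
    define B where "B = char_matrix A a"
    have B: "B \<in> carrier_mat n n" using A by (simp add: B_def)
    have symB: "transpose_mat B = B"
    proof (rule eq_matI)
      fix i j assume ij: "i < dim_row B" "j < dim_col B"
      then have "A $$ (j, i) = A $$ (i, j)"
        using A B sym by (metis carrier_matD index_transpose_mat(1))
      then show "transpose_mat B $$ (i, j) = B $$ (i, j)"
        using ij A B by (auto simp: B_def char_matrix_def)
    qed (use B in simp_all)
    have B2: "B ^\<^sub>m 2 = B * B" and B1: "B ^\<^sub>m 1 = B" using B by (simp_all add: numeral_2_eq_2)
    have "mat_kernel (B * B) = mat_kernel B"
    proof (rule Set.equalityI)
      show "mat_kernel B \<subseteq> mat_kernel (B * B)" by (rule mat_kernel_mult_subset[OF B B])
      show "mat_kernel (B * B) \<subseteq> mat_kernel B"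
      proof
        fix x assume "x \<in> mat_kernel (B * B)"
        then have x: "x \<in> carrier_vec n" "B *\<^sub>v (B *\<^sub>v x) = 0\<^sub>v n"
          using mat_kernelD[of "B * B" n n] B by (simp_all add: assoc_mult_mat_vec[OF B B])
        have Bx: "B *\<^sub>v x \<in> carrier_vec n" using B x by simp
        have "(B *\<^sub>v x) \<bullet> (B *\<^sub>v x) = x \<bullet> (B *\<^sub>v (B *\<^sub>v x))"
          using transpose_vec_mult_scalar[OF B Bx x(1)] symB by simp
        also have "\<dots> = 0" using x by simp
        finally have "B *\<^sub>v x = 0\<^sub>v n"
          using conjugate_square_eq_0_vec[OF Bx] by simp
        then show "x \<in> mat_kernel B" by (rule mat_kernelI[OF B x(1)])
      qed
    qed
    then have "kernel_dim (B ^\<^sub>m 2) = kernel_dim (B ^\<^sub>m 1)"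
      unfolding B1 B2 kernel_dim_def by simp
    then have "dim_gen_eigenspace A a 2 = dim_gen_eigenspace A a 1"
      by (simp add: dim_gen_eigenspace_def B_def)
    then have eq: "(\<Sum>k\<leftarrow>map fst [(k, e)\<leftarrow>n_as. e = a]. min 2 k)
        = (\<Sum>k\<leftarrow>map fst [(k, e)\<leftarrow>n_as. e = a]. min 1 k)"
      unfolding dim_gen_eigenspace[OF jnf] .
    \<comment> \<open>Equality of the two sums forces equality in every term, as each inequality goes one way.\<close>
    have "k \<le> 1" if "(\<Sum>k\<leftarrow>ks. min 2 k) = (\<Sum>k\<leftarrow>ks. min 1 k)" "k \<in> set ks"
      for k and ks :: "nat list"
      using that
    proof (induction ks)
      case (Cons j ks)
      have "(\<Sum>k\<leftarrow>ks. min 1 k) \<le> (\<Sum>k\<leftarrow>ks. min 2 k)" by (rule sum_list_mono) simp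
      with Cons.prems(1) have "min 2 j \<le> min 1 j" "(\<Sum>k\<leftarrow>ks. min 2 k) = (\<Sum>k\<leftarrow>ks. min 1 k)"
        by auto
      then show ?case using Cons by (auto simp: min_def split: if_splits)
    qed simp
    from this[OF eq, of m] have "m \<le> 1" using mem by force
    moreover have "m \<noteq> 0" using jnf mem by (force simp: jordan_nf_def)
    ultimately show ?thesis by simp
  qed
  have "diagonal_mat (jordan_matrix n_as)" by (rule diagonal_jordan_matrix) (rule block)
  with jnf show thesis using that by (auto simp: jordan_nf_def)
qed

section \<open>Eigenvalue multiplicities and determining sets\<close>

text \<open>
  Padding the system with zero rows gives a square singular matrix.
\<close>

lemma underdetermined_system_nontrivial_solution:
  fixes rs :: "'a :: field vec list"
  assumes "set rs \<subseteq> carrier_vec n" and "length rs < n"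
  obtains y where "y \<in> carrier_vec n" and "y \<noteq> 0\<^sub>v n" and "\<And>r. r \<in> set rs \<Longrightarrow> r \<bullet> y = 0"
proof -
  define c where "c i = (if i < length rs then rs ! i else 0\<^sub>v n)" for i
  define M where "M = mat\<^sub>r n n (\<lambda>i. if i = n - 1 then 0\<^sub>v n else c i)"
  have c: "c i \<in> carrier_vec n" for i
    using assms(1) by (auto simp: c_def)
  have M: "M \<in> carrier_mat n n" by (simp add: M_def)
  have "det M = 0" unfolding M_def using assms(2) c by (intro det_row_0) auto
  then obtain y where y: "y \<in> carrier_vec n" "y \<noteq> 0\<^sub>v n" "M *\<^sub>v y = 0\<^sub>v n"
    using det_0_iff_vec_prod_zero_field[OF M] by blast
  have "r \<bullet> y = 0" if r: "r \<in> set rs" for r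
  proof -
    obtain i where i: "i < length rs" "r = rs ! i" using r by (auto simp: in_set_conv_nth)
    have "(M *\<^sub>v y) $ i = row M i \<bullet> y" using i assms(2) M by simp
    moreover have "row M i = r"
      using i assms(2) c[of i] by (auto simp: M_def c_def row_mat_of_row_fun)
    ultimately show ?thesis using y i assms(2) by simp
  qed
  with y that show thesis by blast
qed

text \<open>
  If restriction to the coordinates in \<open>Z\<close> is injective on every eigenspace, then every eigenvalue has
  multiplicity at most \<open>card Z\<close>, and for a diagonalizable matrix the multiplicities add up to the
  dimension. The multiplicity of \<open>\<mu>\<close> is counted as the number of indices in \<open>L \<mu>\<close>, the positions
  of \<open>\<mu>\<close> on the diagonal of \<open>J\<close>; the columns of \<open>P\<close> at these positions are independent eigenvectors.
\<close>

lemma dim_le_card_spectrum_times_card_determining_set: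
  fixes A :: "'a :: field mat"
  assumes A: "A \<in> carrier_mat n n" and sim: "similar_mat A J" and diag: "diagonal_mat J"
    and Z: "Z \<subseteq> {..<n}"
    and determining: "\<And>\<mu> x. x \<in> carrier_vec n \<Longrightarrow> A *\<^sub>v x = \<mu> \<cdot>\<^sub>v x \<Longrightarrow>
      (\<And>j. j \<in> Z \<Longrightarrow> x $ j = 0) \<Longrightarrow> x = 0\<^sub>v n"
  shows "n \<le> card (spectrum A) * card Z"
proof -
  obtain P Q where "similar_mat_wit A J P Q" using sim by (auto simp: similar_mat_def)
  then have P: "P \<in> carrier_mat n n" and Q: "Q \<in> carrier_mat n n" and J: "J \<in> carrier_mat n n"
    and QP: "Q * P = 1\<^sub>m n" and APJQ: "A = P * J * Q"
    using A by (auto simp: similar_mat_wit_def Let_def)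
  have AP: "A * P = P * J"
    unfolding APJQ using P Q J QP by (simp add: assoc_mult_mat[of _ n n _ n _ n])
  define L where "L \<mu> = {i. i < n \<and> J $$ (i, i) = \<mu>}" for \<mu>
  have eig: "A *\<^sub>v (P *\<^sub>v y) = \<mu> \<cdot>\<^sub>v (P *\<^sub>v y)"
    if y: "y \<in> carrier_vec n" and supp: "\<And>i. i < n \<Longrightarrow> i \<notin> L \<mu> \<Longrightarrow> y $ i = 0" for y \<mu>
  proof -
    have "J *\<^sub>v y = \<mu> \<cdot>\<^sub>v y"
    proof (rule eq_vecI)
      fix i assume "i < dim_vec (\<mu> \<cdot>\<^sub>v y)"
      then have i: "i < n" using y by simp
      have "(J *\<^sub>v y) $ i = (\<Sum>j\<in>{0..<n}. J $$ (i, j) * y $ j)"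
        using i J y by (simp add: scalar_prod_def)
      also have "\<dots> = (\<Sum>j\<in>{0..<n}. if j = i then J $$ (i, i) * y $ i else 0)"
        using diag J i by (intro sum.cong) (auto simp: diagonal_mat_def)
      also have "\<dots> = \<mu> * y $ i"
        using i supp[OF i] by (auto simp: L_def)
      finally show "(J *\<^sub>v y) $ i = (\<mu> \<cdot>\<^sub>v y) $ i" using i y by simp
    qed (use J y in simp)
    then have "P *\<^sub>v (J *\<^sub>v y) = \<mu> \<cdot>\<^sub>v (P *\<^sub>v y)"
      using mult_mat_vec[OF P y] by simp
    then show ?thesis
      using A P J y AP by (metis assoc_mult_mat_vec)
  qed
  have inj: "y = 0\<^sub>v n" if "y \<in> carrier_vec n" "P *\<^sub>v y = 0\<^sub>v n" for y
  proof -
    have "y = Q *\<^sub>v (P *\<^sub>v y)" using P Q QP that(1) by (metis assoc_mult_mat_vec one_mult_mat_vec)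
    also have "\<dots> = 0\<^sub>v n" using that Q by (intro eq_vecI) auto
    finally show ?thesis .
  qed
  have L_le: "card (L \<mu>) \<le> card Z" for \<mu>
  proof (rule ccontr)
    assume "\<not> card (L \<mu>) \<le> card Z"
    moreover have finZ: "finite Z" using Z finite_subset by blast
    moreover have Ln: "L \<mu> \<subseteq> {..<n}" by (auto simp: L_def)
    moreover have "card ({..<n} - L \<mu>) = n - card (L \<mu>)" "card (L \<mu>) \<le> n"
      using Ln by (simp_all add: card_Diff_subset finite_subset subset_eq_atLeast0_lessThan_card lessThan_atLeast0)
    ultimately have less: "card ({..<n} - L \<mu>) + card Z < n" by linarith
    \<comment> \<open>The equations say that \<open>y\<close> is supported in \<open>L \<mu>\<close>, so that \<open>P *\<^sub>v y\<close> is an eigenvector,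
      and that \<open>P *\<^sub>v y\<close> vanishes on \<open>Z\<close>.\<close>
    define rs where "rs = map (unit_vec n) (sorted_list_of_set ({..<n} - L \<mu>))
      @ map (row P) (sorted_list_of_set Z)"
    have "length rs < n" using less by (simp add: rs_def)
    moreover have "set rs \<subseteq> carrier_vec n" using P Z finZ by (auto simp: rs_def)
    ultimately obtain y where y: "y \<in> carrier_vec n" "y \<noteq> 0\<^sub>v n"
      and rs0: "\<And>r. r \<in> set rs \<Longrightarrow> r \<bullet> y = 0"
      using underdetermined_system_nontrivial_solution by metis
    have "y $ i = 0" if "i < n" "i \<notin> L \<mu>" for i
      using rs0[of "unit_vec n i"] that y by (simp add: rs_def)
    from eig[OF y(1) this] have "A *\<^sub>v (P *\<^sub>v y) = \<mu> \<cdot>\<^sub>v (P *\<^sub>v y)" .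
    moreover have "(P *\<^sub>v y) $ j = 0" if "j \<in> Z" for j
      using rs0[of "row P j"] that Z P finZ by (auto simp: rs_def)
    ultimately have "P *\<^sub>v y = 0\<^sub>v n" using determining[of "P *\<^sub>v y" \<mu>] P y by simp
    with inj[OF y(1)] y(2) show False by simp
  qed
  have "J $$ (i, i) \<in> spectrum A" if i: "i < n" for i
  proof -
    have "A *\<^sub>v (P *\<^sub>v unit_vec n i) = J $$ (i, i) \<cdot>\<^sub>v (P *\<^sub>v unit_vec n i)"
      using i by (intro eig) (auto simp: L_def)
    moreover have "P *\<^sub>v unit_vec n i \<noteq> 0\<^sub>v n" using inj[of "unit_vec n i"] i by auto
    ultimately have "eigenvector A (P *\<^sub>v unit_vec n i) (J $$ (i, i))"
      using A P by (simp add: eigenvector_def)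
    then show ?thesis by (auto simp: spectrum_def eigenvalue_def)
  qed
  then have "{..<n} \<subseteq> (\<Union>\<mu>\<in>spectrum A. L \<mu>)" by (auto simp: L_def)
  moreover have fin: "finite (spectrum A)" using card_finite_spectrum[OF A] by simp
  ultimately have "n \<le> card (\<Union>\<mu>\<in>spectrum A. L \<mu>)"
    by (metis card_lessThan card_mono finite_UN_I finite_Collect_conjI finite_Collect_less_nat L_def)
  also have "\<dots> \<le> (\<Sum>\<mu>\<in>spectrum A. card (L \<mu>))" by (rule card_UN_le[OF fin])
  also have "\<dots> \<le> card (spectrum A) * card Z" using sum_bounded_above[OF L_le] by simp
  finally show ?thesis .
qed

section \<open>Forcing chains bound the number of eigenvalues\<close>

text \<open>
  For the first pair \<open>(v, c)\<close> of the chain, look at row \<open>v\<close> of \<open>M x = \<mu> x\<close>. The right-hand side is zero, as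
  \<open>v\<close> is not a column of the chain. On the left, \<open>v\<close> is not adjacent to any later column and \<open>x\<close>
  vanishes off the columns, so only the term of \<open>c\<close> survives, with a nonzero coefficient. Hence
  \<open>x\<close> vanishes at \<open>c\<close>, and the rest of the chain takes over.
\<close>

lemma forcing_chain_determines_eigenvectors:
  fixes M :: "'b :: field mat"
  assumes M: "M \<in> carrier_mat (length vs) (length vs)"
    and pattern: "\<And>i j. i < length vs \<Longrightarrow> j < length vs \<Longrightarrow> i \<noteq> j \<Longrightarrow>
      M $$ (i, j) \<noteq> 0 \<longleftrightarrow> {vs ! i, vs ! j} \<in> E"
    and E: "\<And>e. e \<in> E \<Longrightarrow> e \<subseteq> set vs \<and> card e = 2" and dist: "distinct vs"
    and x: "x \<in> carrier_vec (length vs)" "M *\<^sub>v x = \<mu> \<cdot>\<^sub>v x"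
    and chain: "forcing_chain E ps"
    and vanish: "\<And>j. j < length vs \<Longrightarrow> vs ! j \<notin> snd ` set ps \<Longrightarrow> x $ j = 0"
  shows "x = 0\<^sub>v (length vs)"
  using chain vanish
proof (induction ps)
  case Nil
  then show ?case using x by (intro eq_vecI) auto
next
  case (Cons p ps)
  obtain v c where p: "p = (v, c)" by (cases p)
  have vc: "{v, c} \<in> E" and later: "\<And>c'. c' \<in> snd ` set ps \<Longrightarrow> v \<noteq> c' \<and> {v, c'} \<notin> E"
    and ps: "forcing_chain E ps" using Cons.prems(1) by (auto simp: p)
  have "v \<noteq> c" using E[OF vc] by auto
  have "v \<in> set vs" "c \<in> set vs" using E[OF vc] by auto
  then obtain i k where i: "i < length vs" "vs ! i = v" and k: "k < length vs" "vs ! k = c"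
    by (metis in_set_conv_nth)
  have ik: "i \<noteq> k" using \<open>v \<noteq> c\<close> i k by auto
  have "x $ k = 0"
  proof -
    have "(M *\<^sub>v x) $ i = (\<Sum>j\<in>{0..<length vs}. M $$ (i, j) * x $ j)"
      using i M x(1) by (simp add: scalar_prod_def)
    also have "\<dots> = (\<Sum>j\<in>{0..<length vs}. if j = k then M $$ (i, k) * x $ k else 0)"
    proof (rule sum.cong[OF refl])
      fix j assume "j \<in> {0..<length vs}"
      then have j: "j < length vs" by simp
      show "M $$ (i, j) * x $ j = (if j = k then M $$ (i, k) * x $ k else 0)"
      proof (cases "j = k")
        case False
        then have "vs ! j \<noteq> c" using dist j k by (metis nth_eq_iff_index_eq)
        show ?thesis
        proof (cases "vs ! j \<in> snd ` set ps")
          case True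
          then have "i \<noteq> j" "M $$ (i, j) = 0"
            using later[OF True] i j pattern[of i j] by auto
          then show ?thesis using False by simp
        next
          case notin: False
          then have "x $ j = 0" using Cons.prems(2)[OF j] \<open>vs ! j \<noteq> c\<close> by (simp add: p)
          then show ?thesis using False by simp
        qed
      qed simp
    qed
    also have "\<dots> = M $$ (i, k) * x $ k" using k by simp
    finally have "M $$ (i, k) * x $ k = \<mu> * x $ i" using x i by simp
    also have "x $ i = 0"
      using Cons.prems(2)[OF i(1)] later \<open>v \<noteq> c\<close> i(2) by (auto simp: p)
    finally show ?thesis using pattern[OF i(1) k(1) ik] vc i k by simp
  qed
  moreover have "j = k" if "j < length vs" "vs ! j = c" for j
    using that k dist by (metis nth_eq_iff_index_eq)
  ultimately show ?case using Cons.IH[OF ps] Cons.prems(2) by (auto simp: p)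
qed

lemma card_spectrum_lower_bound:
  fixes M :: "real mat"
  assumes M: "M \<in> carrier_mat (length vs) (length vs)" and sym: "transpose_mat M = M"
    and pattern: "\<And>i j. i < length vs \<Longrightarrow> j < length vs \<Longrightarrow> i \<noteq> j \<Longrightarrow>
      M $$ (i, j) \<noteq> 0 \<longleftrightarrow> {vs ! i, vs ! j} \<in> E"
    and E: "\<And>e. e \<in> E \<Longrightarrow> e \<subseteq> set vs \<and> card e = 2" and dist: "distinct vs"
    and chain: "forcing_chain E ps"
  shows "length vs \<le> card (spectrum M) * (length vs - length ps)"
proof -
  define Z where "Z = {j. j < length vs \<and> vs ! j \<notin> snd ` set ps}"
  obtain J where J: "similar_mat M J" "diagonal_mat J"
    using real_symmetric_diagonalizable[OF M sym] .
  have "length vs \<le> card (spectrum M) * card Z"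
  proof (rule dim_le_card_spectrum_times_card_determining_set[OF M J])
    show "Z \<subseteq> {..<length vs}" by (auto simp: Z_def)
    show "x = 0\<^sub>v (length vs)" if "x \<in> carrier_vec (length vs)" "M *\<^sub>v x = \<mu> \<cdot>\<^sub>v x"
      "\<And>j. j \<in> Z \<Longrightarrow> x $ j = 0" for \<mu> x
      using forcing_chain_determines_eigenvectors[OF M pattern E dist that(1,2) chain] that(3)
      by (simp add: Z_def)
  qed
  also have "card Z = length vs - length ps"
  proof -
    have "snd ` set ps \<subseteq> set vs" using forcing_chain_edge[OF chain] E by fastforce
    moreover have "card (snd ` set ps) = length ps"
      using distinct_card[OF forcing_chain_distinct[OF chain]] by simp
    ultimately have "card (set vs - snd ` set ps) = length vs - length ps"
      using dist by (simp add: card_Diff_subset distinct_card)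
    moreover have "(!) vs ` Z = set vs - snd ` set ps"
      by (auto simp: Z_def in_set_conv_nth)
    moreover have "inj_on ((!) vs) Z"
      using dist by (auto simp: Z_def inj_on_def nth_eq_iff_index_eq)
    ultimately show ?thesis by (metis card_image)
  qed
  finally show ?thesis .
qed

lemma vdegree_pos:
  assumes "graph G" and "e \<in> edges G" and "v \<in> e"
  shows "vdegree G v > 0"
proof -
  have "edges G \<subseteq> Pow (verts G)" using assms(1) by (auto simp: graph_def)
  then have "finite (edges G)" using assms(1) by (auto simp: graph_def intro: finite_subset)
  then show ?thesis using assms by (auto simp: vdegree_def card_gt_0_iff)
qed

section \<open>Distinct eigenvalues of graphs with a large induced forest\<close>

theorem corollary22:
  fixes G F :: "'a ugraph" and vs :: "'a list" and \<epsilon> :: real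
  assumes "0 < \<epsilon>" and "\<epsilon> < 1"
    and "graph G"
    and "distinct vs" and "set vs = verts G"
    and "induced_subgraph F G" and "forest F" and "isolated_vertices F = {}"
    and "real (card (verts F)) - real (card (leaves F)) + real (card (components F))
           \<ge> \<epsilon> * real (card (verts G))"
  shows "real (card (spectrum (laplacian G vs))) \<ge> 1 / (1 - \<epsilon>) \<and>
         real (card (spectrum (normalized_laplacian G vs))) \<ge> 1 / (1 - \<epsilon>) \<and>
         real (card (spectrum (adjacency_matrix G vs))) \<ge> 1 / (1 - \<epsilon>)"
proof -
  let ?n = "length vs"
  have n: "?n = card (verts G)" "?n > 0"
    using assms(3-5) distinct_card[of vs] by (auto simp: graph_def)
  have E: "e \<subseteq> set vs \<and> card e = 2" if "e \<in> edges G" for e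
    using that assms(3,5) by (auto simp: graph_def)
  obtain ps where ps: "forcing_chain (edges F) ps"
    and len: "card (verts F) + card (components F) \<le> length ps + card (leaves F)"
    using forcing_chain_of_forest_without_isolated_vertices[OF assms(7,8)] .
  have FG: "e \<in> edges F \<longleftrightarrow> e \<in> edges G" if "e \<subseteq> verts F" for e
    using assms(6) that by (simp add: induced_subgraph_def)
  have vertsF: "fst p \<in> verts F \<and> snd p \<in> verts F" if "p \<in> set ps" for p
  proof -
    have "{fst p, snd p} \<in> edges F" using forcing_chain_edge[OF ps, of "fst p" "snd p"] that by simp
    then have "{fst p, snd p} \<subseteq> verts F" using assms(7) unfolding forest_def graph_def by blast
    then show ?thesis by simp
  qed
  have chainG: "forcing_chain (edges G) ps"
  proof (rule forcing_chain_cong[OF ps])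
    fix v c assume "v \<in> fst ` set ps" "c \<in> snd ` set ps"
    then show "{v, c} \<in> edges F \<longleftrightarrow> {v, c} \<in> edges G" using vertsF by (intro FG) blast
  qed
  note bound = card_spectrum_lower_bound[OF _ _ _ E assms(4) chainG]
  \<comment> \<open>The hypothesis on \<open>F\<close> says that the chain has length at least \<open>\<epsilon> * n\<close>, so at most
    \<open>(1 - \<epsilon>) * n\<close> vertices are left over.\<close>
  have conclude: "real (card (spectrum M)) \<ge> 1 / (1 - \<epsilon>)"
    if "?n \<le> card (spectrum M) * (?n - length ps)" for M :: "real mat"
  proof -
    have "length ps < ?n" using that n by (cases "length ps < ?n") auto
    then have "real (?n - length ps) = real ?n - real (length ps)" by simp
    also have "\<dots> \<le> (1 - \<epsilon>) * real ?n"
      using len assms(9) n(1) by (simp add: algebra_simps)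
    finally have "real (?n - length ps) \<le> (1 - \<epsilon>) * real ?n" .
    then have "real (card (spectrum M)) * real (?n - length ps)
        \<le> real (card (spectrum M)) * ((1 - \<epsilon>) * real ?n)"
      by (rule mult_left_mono) simp
    moreover have "real ?n \<le> real (card (spectrum M)) * real (?n - length ps)"
      using that by (metis of_nat_le_iff of_nat_mult)
    ultimately have "1 * real ?n \<le> (real (card (spectrum M)) * (1 - \<epsilon>)) * real ?n" by simp
    then have "1 \<le> real (card (spectrum M)) * (1 - \<epsilon>)"
      using n(2) by (simp only: mult_le_cancel_right)
    then show ?thesis using assms(2) by (simp add: divide_le_eq)
  qed
  have "?n \<le> card (spectrum (laplacian G vs)) * (?n - length ps)"
    by (rule bound)
      (auto simp: laplacian_def degree_matrix_def adjacency_matrix_def insert_commute)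
  moreover have "?n \<le> card (spectrum (normalized_laplacian G vs)) * (?n - length ps)"
  proof (rule bound)
    show "normalized_laplacian G vs \<in> carrier_mat ?n ?n"
      by (simp add: normalized_laplacian_def)
    show "transpose_mat (normalized_laplacian G vs) = normalized_laplacian G vs"
      by (intro eq_matI) (auto simp: normalized_laplacian_def insert_commute mult.commute)
    show "normalized_laplacian G vs $$ (i, j) \<noteq> 0 \<longleftrightarrow> {vs ! i, vs ! j} \<in> edges G"
      if "i < ?n" "j < ?n" "i \<noteq> j" for i j
      using that vdegree_pos[OF assms(3), of "{vs ! i, vs ! j}"]
      by (auto simp: normalized_laplacian_def)
  qed
  moreover have "?n \<le> card (spectrum (adjacency_matrix G vs)) * (?n - length ps)"
    by (rule bound) (auto simp: adjacency_matrix_def insert_commute)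
  ultimately show ?thesis using conclude by blast
qed

end
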